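(* Let $n\ge 1$, let $\lambda$ be a partition of the integer $n$, and let $\Pi_n$ be a spreadable random partition of $[n]$ with constant ranked shape, i.e. $s^\downarrow(\Pi_n)=\lambda$ almost surely. Then $\Pi_n$ is exchangeable, with distribution uniform on the set of all partitions of $[n]$ with ranked shape $\lambda$ (that is, its probability function is $p^*_\lambda$), and the distribution of $\Pi_n$ is an extreme point of the convex polytope of all spreadable distributions on $\mathcal P_n$.
   Context: $[n]=\{1,\dots,n\}$, and $\mathcal P_n$ is the finite set of all set partitions of $[n]$. A random partition of $[n]$ is a random variable $\Pi_n$ with values in $\mathcal P_n$. The ranked shape $s^\downarrow(\pi_n)$ is the partition of the integer $n$ obtained by listing the block sizes of $\pi_n$ in nonincreasing order. For $1\le j\le n$ the operator $D_j:\mathcal P_n\to\mathcal P_{n-1}$ deletes the element $j$ from its block (removing the block if it becomes empty) and then relabels the remaining elements by $[n-1]$ via the increasing bijection. A random partition $\Pi_n$ (equivalently, its distribution on $\mathcal P_n$) is called spreadable if $D_1\Pi_n\stackrel{d}{=}D_2\Pi_n\stackrel{d}{=}\cdots\stackrel{d}{=}D_n\Pi_n$. It is called exchangeable if $\mathbb P[\Pi_n=\pi_n]$ depends only on $s^\downarrow(\pi_n)$; equivalently, its distribution is invariant under all permutations of $[n]$. $p^*_\lambda$ denotes the symmetric probability function corresponding to the uniform distribution over the partitions of $[n]$ with ranked shape $\lambda$. *)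

theory Defs
  imports "HOL-Probability.Probability" "HOL-Library.Function_Algebras"
begin

text \<open>
  Probability functions on the set partitions of \<open>[n]\<close> are real-valued functions; the pointwise
  real vector space structure makes \<^const>\<open>extreme_point_of\<close> and \<^const>\<open>convex\<close> available for them.
\<close>

instantiation "fun" :: (type, real_vector) real_vector
begin

definition scaleR_fun :: "real \<Rightarrow> ('a \<Rightarrow> 'b) \<Rightarrow> 'a \<Rightarrow> 'b"
  where "scaleR_fun c f = (\<lambda>x. c *\<^sub>R f x)"

instance
  by standard (simp_all add: scaleR_fun_def fun_eq_iff scaleR_add_right scaleR_add_left)

end

definition set_partitions :: "nat \<Rightarrow> nat set set set"
  where "set_partitions n = {\<pi>. partition_on {1..n} \<pi>}"

definition integer_partition :: "nat \<Rightarrow> nat list \<Rightarrow> bool"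
  where "integer_partition n xs \<longleftrightarrow>
    sorted_wrt (\<ge>) xs \<and> (\<forall>k\<in>set xs. 0 < k) \<and> sum_list xs = n"

definition ranked_shape :: "nat set set \<Rightarrow> nat list"
  where "ranked_shape \<pi> = rev (sorted_list_of_multiset (image_mset card (mset_set \<pi>)))"

definition relabel :: "nat \<Rightarrow> nat \<Rightarrow> nat"
  where "relabel j x = (if x < j then x else x - 1)"

lemma relabel_increasing_bijection:
  assumes "j \<in> {1..n}"
  shows "bij_betw (relabel j) ({1..n} - {j}) {1..n - 1}"
    and "strict_mono_on ({1..n} - {j}) (relabel j)"
proof -
  show mono: "strict_mono_on ({1..n} - {j}) (relabel j)"
    using assms by (auto simp: strict_mono_on_def relabel_def)
  have "relabel j ` ({1..n} - {j}) \<subseteq> {1..n - 1}"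
    using assms by (auto simp: relabel_def)
  moreover have inj: "inj_on (relabel j) ({1..n} - {j})"
    using mono by (rule strict_mono_on_imp_inj_on)
  moreover have "card ({1..n} - {j}) = card {1..n - 1}"
    using assms by simp
  ultimately show "bij_betw (relabel j) ({1..n} - {j}) {1..n - 1}"
    by (metis bij_betw_def card_image card_subset_eq finite_atLeastAtMost)
qed

definition delete_element :: "nat \<Rightarrow> nat set set \<Rightarrow> nat set set"
  where "delete_element j \<pi> = (\<lambda>B. relabel j ` B) ` ((\<lambda>B. B - {j}) ` \<pi> - {{}})"

lemma delete_element_in_set_partitions:
  assumes "\<pi> \<in> set_partitions n" "j \<in> {1..n}"
  shows "delete_element j \<pi> \<in> set_partitions (n - 1)"
proof -
  let ?P = "(\<lambda>B. B - {j}) ` \<pi> - {{}}"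
  have "partition_on {1..n} \<pi>"
    using assms by (simp add: set_partitions_def)
  then have P: "partition_on ({1..n} - {j}) ?P"
    by (rule partition_on_transform) (auto simp: disjnt_def)
  have bij: "bij_betw (relabel j) ({1..n} - {j}) {1..n - 1}"
    by (rule relabel_increasing_bijection(1)[OF assms(2)])
  have "partition_on (relabel j ` ({1..n} - {j})) ((\<lambda>B. relabel j ` B) ` ?P - {{}})"
    by (rule partition_on_inj_image[OF P]) (rule bij_betw_imp_inj_on[OF bij])
  moreover have "(\<lambda>B. relabel j ` B) ` ?P - {{}} = delete_element j \<pi>"
    by (auto simp: delete_element_def)
  ultimately show ?thesis
    unfolding set_partitions_def bij_betw_imp_surj_on[OF bij] by (metis mem_Collect_eq)
qed

definition random_partition :: "nat \<Rightarrow> 'w measure \<Rightarrow> ('w \<Rightarrow> nat set set) \<Rightarrow> bool"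
  where "random_partition n M X \<longleftrightarrow>
    prob_space M \<and> X \<in> measurable M (count_space (set_partitions n))"

definition spreadable :: "nat \<Rightarrow> 'w measure \<Rightarrow> ('w \<Rightarrow> nat set set) \<Rightarrow> bool"
  where "spreadable n M X \<longleftrightarrow>
    (\<forall>i\<in>{1..n}. \<forall>j\<in>{1..n}.
      distr M (count_space (set_partitions (n - 1))) (\<lambda>w. delete_element i (X w)) =
      distr M (count_space (set_partitions (n - 1))) (\<lambda>w. delete_element j (X w)))"

definition exchangeable :: "nat \<Rightarrow> 'w measure \<Rightarrow> ('w \<Rightarrow> nat set set) \<Rightarrow> bool"
  where "exchangeable n M X \<longleftrightarrow>
    (\<forall>\<pi>\<in>set_partitions n. \<forall>\<pi>'\<in>set_partitions n. ranked_shape \<pi> = ranked_shape \<pi>' \<longrightarrow>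
      \<P>(w in M. X w = \<pi>) = \<P>(w in M. X w = \<pi>'))"

definition probability_function :: "'w measure \<Rightarrow> ('w \<Rightarrow> nat set set) \<Rightarrow> nat set set \<Rightarrow> real"
  where "probability_function M X = (\<lambda>\<pi>. \<P>(w in M. X w = \<pi>))"

definition partitions_of_shape :: "nat \<Rightarrow> nat list \<Rightarrow> nat set set set"
  where "partitions_of_shape n xs = {\<pi> \<in> set_partitions n. ranked_shape \<pi> = xs}"

definition p_star :: "nat \<Rightarrow> nat list \<Rightarrow> nat set set \<Rightarrow> real"
  where "p_star n xs \<pi> =
    (if \<pi> \<in> partitions_of_shape n xs then 1 / real (card (partitions_of_shape n xs)) else 0)"

text \<open>
  A distribution \<open>\<mu>\<close> on the set partitions of \<open>[n]\<close> is spreadable if the identity, regarded as a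
  random partition on the probability space \<open>\<mu>\<close>, is.  Distributions are identified with their
  probability functions, which vanish off \<^term>\<open>set_partitions n\<close>.
\<close>

definition spreadable_distributions :: "nat \<Rightarrow> (nat set set \<Rightarrow> real) set"
  where "spreadable_distributions n =
    {probability_function \<mu> (\<lambda>\<pi>. \<pi>) | \<mu>.
      prob_space \<mu> \<and> sets \<mu> = sets (count_space (set_partitions n)) \<and> spreadable n \<mu> (\<lambda>\<pi>. \<pi>)}"

end

theory Submission
  imports Defs
begin

text \<open>
  Write a partition as the word whose \<open>i\<close>th letter names the block of \<open>i\<close>, so that the probability
  function becomes a function \<open>P\<close> of words that is invariant under renaming the letters.
  Spreadability says that, for a word \<open>u x v\<close> of length \<open>n - 1\<close>, the sums of \<open>P(u c x v)\<close> and of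
  \<open>P(u x c v)\<close> over all letters \<open>c\<close>, a fresh one included, agree. One shows by induction on \<open>k\<close>
  that letters occurring fewer than \<open>k\<close> times can be moved freely without changing \<open>P\<close>. For the
  step, let \<open>c\<close> occur \<open>k\<close> times and stand next to a letter \<open>x\<close> that occurs at least \<open>k\<close> times.
  Because the shape is constant, the only letters contributing to the two sums are \<open>c\<close> and those
  occurring exactly \<open>k - 1\<close> times. By the induction hypothesis the latter may be placed directly
  behind the other occurrences of \<open>c\<close>; then they are indistinguishable from \<open>c\<close>, all terms of
  each sum are equal, and \<open>c\<close> can be exchanged with \<open>x\<close>.

  Extremality follows: a convex decomposition of the uniform distribution on a shape only involves
  spreadable distributions concentrated on that shape, which are uniform by the first part.
\<close>

subsection \<open>Spreadable functions of words\<close>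

text \<open>
  The constancy of the shape enters only through the sum of the squared block sizes, which
  increases by \<open>2 k + 1\<close> when a block of size \<open>k\<close> receives an element and so determines \<open>k\<close>.
\<close>

definition sq_sum :: "'a multiset \<Rightarrow> nat"
  where "sq_sum A = (\<Sum>y\<in>set_mset A. (count A y)\<^sup>2)"

lemma sq_sum_add_mset: "sq_sum (add_mset c A) = sq_sum A + 2 * count A c + 1"
proof -
  have "sq_sum A = (\<Sum>y\<in>insert c (set_mset A). (count A y)\<^sup>2)"
    unfolding sq_sum_def by (rule sum.mono_neutral_left) (auto simp: not_in_iff)
  moreover have "(\<Sum>y\<in>set_mset A - {c}. (count (add_mset c A) y)\<^sup>2) = (\<Sum>y\<in>set_mset A - {c}. (count A y)\<^sup>2)"
    by (rule sum.cong) auto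
  ultimately show ?thesis
    by (simp add: sq_sum_def sum.insert_remove power2_eq_square)
qed

section \<open>Rearranging words by adjacent swaps\<close>

lemma move_left_eqI:
  assumes swap: "\<And>u v c x. mset (u @ c # x # v) = m \<Longrightarrow> c \<in> S \<Longrightarrow> P (u @ c # x # v) = P (u @ x # c # v)"
    and "mset (u @ a @ y # v) = m" "y \<in> S \<or> set a \<subseteq> S"
  shows "P (u @ a @ y # v) = P (u @ y # a @ v)"
  using assms(2,3)
proof (induction a arbitrary: v rule: rev_induct)
  case (snoc b a)
  \<comment> \<open>If the letter \<open>b\<close> next to \<open>y\<close> lies outside
    \<open>S\<close>, then \<open>y\<close> lies in \<open>S\<close> and \<open>swap\<close> is used
    backwards.\<close>
  have "P ((u @ a) @ b # y # v) = P ((u @ a) @ y # b # v)"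
  proof (cases "b \<in> S")
    case True
    then show ?thesis
      using snoc.prems by (intro swap) auto
  next
    case False
    then show ?thesis
      using snoc.prems by (intro swap[symmetric]) auto
  qed
  then show ?case
    using snoc.IH[of "b # v"] snoc.prems by auto
qed simp

text \<open>Letters are aligned from the left; \<open>pre\<close> holds those already settled. If
  the next letter \<open>x\<close> lies in \<open>S\<close>, any occurrence of it in
  \<open>ys\<close> can be fetched. Otherwise the equal filters make \<open>x\<close> the first
  letter of \<open>ys\<close> outside \<open>S\<close>, so it only has to pass letters of
  \<open>S\<close>.\<close>

lemma rearrange_eqI:
  assumes swap: "\<And>u v c x. mset (u @ c # x # v) = m \<Longrightarrow> c \<in> S \<Longrightarrow> P (u @ c # x # v) = P (u @ x # c # v)"
    and "mset (pre @ xs) = m" "mset xs = mset ys"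
    and "filter (\<lambda>y. y \<notin> S) xs = filter (\<lambda>y. y \<notin> S) ys"
  shows "P (pre @ xs) = P (pre @ ys)"
  using assms(2-)
proof (induction xs arbitrary: pre ys)
  case (Cons x xs)
  obtain a b where ys: "ys = a @ x # b" and ab: "x \<in> S \<or> set a \<subseteq> S"
  proof (cases "x \<in> S")
    case True
    have "x \<in> set ys"
      using Cons.prems(2) by (metis list.set_intros(1) mset_eq_setD)
    then show ?thesis
      using True that by (meson split_list)
  next
    case False
    then show ?thesis
      using Cons.prems(3) that by (auto simp: Cons_eq_filter_iff)
  qed
  have "P (pre @ ys) = P (pre @ x # a @ b)"
    unfolding ys using Cons.prems ys ab by (intro move_left_eqI[where m = m and S = S] swap) auto
  moreover have "filter (\<lambda>y. y \<notin> S) xs = filter (\<lambda>y. y \<notin> S) (a @ b)"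
    using Cons.prems(3) ab unfolding ys by (auto split: if_splits simp: filter_empty_conv subset_iff)
  then have "P ((pre @ [x]) @ xs) = P ((pre @ [x]) @ a @ b)"
    using Cons.prems ys by (intro Cons.IH) auto
  ultimately show ?case
    by simp
qed simp

lemma filter_eq_singletonI:
  assumes "distinct xs" "{y \<in> set xs. Q y} = {c}"
  shows "filter Q xs = [c]"
proof -
  have *: "set (filter Q xs) = {c}" "distinct (filter Q xs)"
    using assms by auto
  then have "length (filter Q xs) = 1"
    by (metis distinct_card is_singleton_altdef is_singleton_def)
  then obtain y where "filter Q xs = [y]"
    by (auto simp: length_Suc_conv)
  with *(1) show ?thesis
    by (metis empty_set list.simps(15) singleton_inject)
qed

lemma count_image_mset_inj:
  assumes "inj f"
  shows "count (image_mset f A) (f x) = count A x"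
  by (induction A) (use assms in \<open>auto simp: inj_eq\<close>)

text \<open>\<open>P w\<close> is meant as the probability of the partition whose blocks are the
  positions of equal letters. The two sums in \<open>spread\<close> run over the fibres of deletion
  at neighbouring positions: the deleted element carried an old letter or, represented by
  \<open>z\<close>, formed a singleton.\<close>

locale spread_words =
  fixes P :: "nat list \<Rightarrow> real" and n q :: nat
  assumes rename: "inj f \<Longrightarrow> P (map f w) = P w"
    and spread: "Suc (length (u @ x # v)) = n \<Longrightarrow> z \<notin> set (u @ x # v) \<Longrightarrow>
      (\<Sum>c\<in>insert z (set (u @ x # v)). P (u @ c # x # v)) =
      (\<Sum>c\<in>insert z (set (u @ x # v)). P (u @ x # c # v))"
    and support: "length w = n \<Longrightarrow> P w \<noteq> 0 \<Longrightarrow> sq_sum (mset w) = q"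
begin

text \<open>By \<open>IH\<close> only the order of the \<open>big\<close> letters can still matter,
  and \<open>c\<close> is among the rarest of these. So every word may be replaced by one with the
  same multiset and the same subword of big letters, which is the freedom used to build
  \<open>u'\<close> and \<open>v'\<close>.\<close>

lemma swap_step:
  fixes m :: "nat multiset" and k :: nat
  defines "big \<equiv> \<lambda>y. k \<le> count m y"
  assumes m: "size m = n" "sq_sum m = q"
    and IH: "\<And>w w'. mset w = m \<Longrightarrow> mset w' = m \<Longrightarrow> filter big w = filter big w' \<Longrightarrow> P w = P w'"
    and w: "mset (u @ c # x # v) = m" and c: "count m c = k"
  shows "P (u @ c # x # v) = P (u @ x # c # v)"
proof (cases "x = c \<or> \<not> big x")
  case True
  then show ?thesis
    using w by (elim disjE) (auto intro!: IH)
next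
  case False
  then have x: "x \<noteq> c" "big x"
    by auto
  \<comment> \<open>The rearranged word \<open>u' c x v'\<close> has a copy of each letter of \<open>bs\<close> behind every
    occurrence of \<open>c\<close> in \<open>u'\<close> and \<open>v'\<close>.\<close>
  let ?\<tau> = "Transposition.transpose c"
  \<comment> \<open>These letters become as frequent as \<open>c\<close> once one copy of
    \<open>c\<close> is removed. For \<open>k = 1\<close> the list is empty, because letters absent
    from \<open>m\<close> are excluded.\<close>
  obtain bs where bs: "distinct bs" "set bs = {y \<in> set_mset m. Suc (count m y) = k}"
    using finite_distinct_list[of "{y \<in> set_mset m. Suc (count m y) = k}"] by auto
  define cl where "cl y = (if y = c then c # bs else [y])" for y
  define E where "E ys = concat (map cl (filter big ys))" for ys
  define rest where "rest = filter (\<lambda>y. Suc (count m y) < k) (u @ v)"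
  define u' v' where "u' = E u" and "v' = E v @ rest"
  define r where "r = u' @ x # v'"
  have bigc: "big c" and nbig: "\<And>y. y \<in> set bs \<Longrightarrow> \<not> big y" and c_bs: "c \<notin> set bs"
    using c bs by (auto simp: big_def)
  have m_eq: "count m y = count (mset u) y + count (mset v) y + (if y = c then 1 else 0) + (if y = x then 1 else 0)" for y
    using w by (auto simp del: count_mset)
  have count_E: "count (mset (E ys)) y =
      (if y \<in> set bs then count (mset ys) c else if big y then count (mset ys) y else 0)" for ys y
    unfolding E_def
    by (induction ys)
       (use bigc nbig c_bs bs(1) in \<open>auto simp: cl_def distinct_count_atmost_1 simp del: count_mset\<close>)
  \<comment> \<open>Together \<open>u\<close> and \<open>v\<close> contain \<open>k - 1\<close>
    copies of \<open>c\<close>, so \<open>E\<close> produces each letter of \<open>bs\<close>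
    exactly \<open>k - 1\<close> times, its multiplicity in \<open>m\<close>.\<close>
  have r: "add_mset c (mset r) = m"
  proof (rule multiset_eqI)
    fix y
    have "count (mset rest) y = (if Suc (count m y) < k then count (mset u) y + count (mset v) y else 0)"
      unfolding rest_def by (auto simp del: count_mset)
    then have *: "count (add_mset c (mset r)) y = count (mset (E u)) y + count (mset (E v)) y +
        (if Suc (count m y) < k then count (mset u) y + count (mset v) y else 0) +
        (if y = c then 1 else 0) + (if y = x then 1 else 0)"
      by (simp add: r_def u'_def v'_def del: count_mset)
    have kc: "k = count (mset u) c + count (mset v) c + 1"
      using m_eq[of c] c x by (simp del: count_mset)
    consider "y \<in> set bs" | "y \<notin> set bs" "big y" | "Suc (count m y) < k" | "count m y = 0" "Suc (count m y) = k"
    proof -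
      have "y \<in> set bs \<longleftrightarrow> count m y \<noteq> 0 \<and> Suc (count m y) = k"
        by (simp add: bs(2) not_in_iff)
      then show thesis
        using that unfolding big_def by linarith
    qed
    then show "count (add_mset c (mset r)) y = count m y"
    proof cases
      case 1
      then have "Suc (count m y) = k" "y \<noteq> c" "y \<noteq> x"
        using bs(2) c_bs nbig x by auto
      then show ?thesis
        using 1 kc unfolding * count_E by simp
    next
      case 2
      then show ?thesis
        using m_eq[of y] unfolding * count_E by (simp add: big_def)
    next
      case 3
      then have "y \<notin> set bs" "\<not> big y" "y \<noteq> c" "y \<noteq> x"
        using bs(2) bigc x by (auto simp: big_def)
      then show ?thesis
        using 3 m_eq[of y] unfolding * count_E by simp
    next
      case 4
      then have "y \<notin> set bs" "\<not> big y" "y \<noteq> c" "y \<noteq> x"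
        using bs(2) bigc x by (auto simp: big_def not_in_iff)
      then show ?thesis
        using 4 unfolding * count_E by simp
    qed
  qed
  \<comment> \<open>The set of letters of \<open>c # bs\<close> is permuted by \<open>f\<close>, and
    \<open>c\<close> is its only big letter; all other big letters are fixed. So the renaming leaves
    the big subword intact.\<close>
  have filter_E: "filter big (map f (E ys)) = filter big ys"
    if "f = id \<or> (\<exists>c'\<in>set (c # bs). f = ?\<tau> c')" for f ys
  proof -
    have "filter big (map f (c # bs)) = [c]"
    proof (rule filter_eq_singletonI)
      show "distinct (map f (c # bs))"
      proof -
        have "inj f"
          using that by (elim disjE bexE) simp_all
        then have "inj_on f (set (c # bs))"
          by (rule inj_on_subset) simp
        then show ?thesis
          using c_bs bs(1) by (simp only: distinct_map) simp
      qed
      have "f ` set (c # bs) = set (c # bs)"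
        using that by (elim disjE bexE) (simp_all add: transpose_image_eq list.set_intros(1) del: list.set)
      then show "{y \<in> set (map f (c # bs)). big y} = {c}"
        using bigc nbig by (auto simp del: list.map)
    qed
    moreover have "f y = y" if "big y" "y \<noteq> c" for y
      using nbig that \<open>f = id \<or> _\<close> by (auto simp: Transposition.transpose_def)
    ultimately show ?thesis
      unfolding E_def by (induction ys) (auto simp: cl_def)
  qed
  have filter_rest: "filter big (map f rest) = []"
    if "f = id \<or> (\<exists>c'\<in>set (c # bs). f = ?\<tau> c')" for f
    using that c bs(2) by (auto simp: rest_def big_def filter_empty_conv Transposition.transpose_def split: if_splits)
  \<comment> \<open>Exchanging the names \<open>c\<close> and \<open>c'\<close>, which both occur
    \<open>k - 1\<close> times in \<open>r\<close>, turns the left word into one with multiset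
    \<open>m\<close> and the big subword of the right one. So \<open>rename\<close> and then
    \<open>IH\<close> apply.\<close>
  have clone: "P (a @ c' # b) = P (a @ c # b)"
    if ab: "a @ b = r" and c': "c' \<in> set (c # bs)"
      and "filter big (map (?\<tau> c') a) = filter big a"
      and "filter big (map (?\<tau> c') b) = filter big b" for a b c'
  proof -
    have cnt: "count (mset r) c = count (mset r) c'"
      using r c c' bs by (auto split: if_splits simp del: count_mset)
    have "image_mset (?\<tau> c') (mset r) = mset r"
    proof (rule multiset_eqI)
      fix y
      have "count (image_mset (?\<tau> c') (mset r)) (?\<tau> c' (?\<tau> c' y)) = count (mset r) (?\<tau> c' y)"
        by (rule count_image_mset_inj) simp
      then show "count (image_mset (?\<tau> c') (mset r)) y = count (mset r) y"
        using cnt by (auto simp: Transposition.transpose_def simp del: count_mset split: if_splits)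
    qed
    then have *: "mset (map (?\<tau> c') (a @ c' # b)) = m"
      using r ab by auto
    have "P (a @ c' # b) = P (map (?\<tau> c') (a @ c' # b))"
      by (rule rename[symmetric]) simp
    also have "\<dots> = P (a @ c # b)"
      using * r ab that(3,4) by (intro IH) auto
    finally show ?thesis .
  qed
  \<comment> \<open>If the removed copy of \<open>c\<close> was the only one, the fresh letter must
    be \<open>c\<close> itself, so that the sum contains the term for \<open>c\<close>.\<close>
  define z where "z = (if c \<in> set r then SOME z. z \<notin> set r else c)"
  have z: "z \<notin> set r"
    unfolding z_def by (auto intro!: someI_ex[of "\<lambda>z. z \<notin> set r"] ex_new_if_finite)
  have collapse: "(\<Sum>c'\<in>insert z (set r). P (a @ c' # b)) = card (set (c # bs)) * P (a @ c # b)"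
    if ab: "a @ b = r"
      and "\<And>c'. c' \<in> set (c # bs) \<Longrightarrow> filter big (map (?\<tau> c') a) = filter big a"
      and "\<And>c'. c' \<in> set (c # bs) \<Longrightarrow> filter big (map (?\<tau> c') b) = filter big b" for a b
  proof -
    have "(\<Sum>c'\<in>insert z (set r). P (a @ c' # b)) = (\<Sum>c'\<in>set (c # bs). P (a @ c' # b))"
    proof (rule sum.mono_neutral_right)
      have "set_mset (add_mset c (mset r)) = set_mset m"
        using r by simp
      then show "set (c # bs) \<subseteq> insert z (set r)"
        using bs(2) c_bs by (auto simp: z_def)
      show "\<forall>c'\<in>insert z (set r) - set (c # bs). P (a @ c' # b) = 0"
      proof (rule ballI, rule ccontr)
        fix c' assume c': "c' \<in> insert z (set r) - set (c # bs)" and nz: "P (a @ c' # b) \<noteq> 0"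
        have "length (a @ c' # b) = n"
          using r m(1) ab by auto
        then have "sq_sum (add_mset c' (mset r)) = sq_sum (add_mset c (mset r))"
          using support[OF _ nz] ab r m(2) by auto
        then have "count (mset r) c' = count (mset r) c"
          by (simp add: sq_sum_add_mset)
        moreover have cnt: "count m c' = count (mset r) c'" "k = Suc (count (mset r) c)"
          using c' c unfolding r[symmetric] by auto
        ultimately have "Suc (count m c') = k"
          by simp
        \<comment> \<open>The multiplicity of \<open>c'\<close> fits \<open>bs\<close>, so only
          absence from \<open>m\<close> can keep it out. Then \<open>c'\<close> is the fresh letter
          \<open>z\<close>, and \<open>c\<close> is absent from \<open>r\<close> as well, which
          makes \<open>z\<close> equal to \<open>c\<close>.\<close>
        then have "c' \<notin># m"
          using c' bs(2) by auto
        then have "c' \<notin># mset r"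
          unfolding r[symmetric] by simp
        then have "count (mset r) c' = 0" "c' = z"
          using c' by (simp only: not_in_iff[symmetric]) (use \<open>c' \<notin># mset r\<close> c' in auto)
        then have "c \<notin># mset r"
          using \<open>count (mset r) c' = count (mset r) c\<close> by (simp only: not_in_iff)
        with \<open>c' = z\<close> have "c' = c"
          by (simp add: z_def)
        then show False
          using c' by simp
      qed
    qed auto
    also have "\<dots> = (\<Sum>c'\<in>set (c # bs). P (a @ c # b))"
      by (intro sum.cong refl clone ab that)
    finally show ?thesis
      by simp
  qed
  have tx: "?\<tau> c' x = x" if "c' \<in> set (c # bs)" for c'
    using that x nbig by (auto simp: Transposition.transpose_def)
  have "Suc (length r) = n"
    using r m(1) by auto
  then have "(\<Sum>c'\<in>insert z (set r). P (u' @ c' # x # v')) = (\<Sum>c'\<in>insert z (set r). P ((u' @ [x]) @ c' # v'))"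
    using spread[of u' x v' z] z by (simp add: r_def)
  moreover have "filter big (map (?\<tau> c') u') = filter big u'"
    "filter big (map (?\<tau> c') v') = filter big v'" if "c' \<in> set (c # bs)" for c'
  proof -
    have \<tau>: "?\<tau> c' = id \<or> (\<exists>d\<in>set (c # bs). ?\<tau> c' = ?\<tau> d)"
      using that by blast
    show "filter big (map (?\<tau> c') u') = filter big u'" "filter big (map (?\<tau> c') v') = filter big v'"
      using filter_E[of id] filter_rest[of id]
      by (simp_all add: u'_def v'_def filter_E[OF \<tau>] filter_rest[OF \<tau>])
  qed
  \<comment> \<open>Both sides of the spreadability identity collapse to the same positive multiple
    of one term. On the right this is done with \<open>u' @ [x]\<close>, since the renamings fix
    \<open>x\<close>.\<close>
  ultimately have "card (set (c # bs)) * P (u' @ c # x # v') = card (set (c # bs)) * P ((u' @ [x]) @ c # v')"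
    by (subst (asm) (1 2) collapse) (auto simp: r_def tx simp del: set_simps)
  then have "P (u' @ c # x # v') = P (u' @ x # c # v')"
    by (simp add: card_gt_0_iff)
  moreover have "P (u @ c # x # v) = P (u' @ c # x # v')" "P (u @ x # c # v) = P (u' @ x # c # v')"
    using w r filter_E[of id] filter_rest[of id]
    by (auto intro!: IH simp: r_def u'_def v'_def)
  ultimately show ?thesis
    by simp
qed

text \<open>Induction on the threshold: at \<open>k = 0\<close> the filters keep everything and the
  words coincide. In the step, letters occurring exactly \<open>k\<close> times are moved by
  \<open>swap_step\<close> and rarer ones by the induction hypothesis.\<close>

lemma eq_if_big_eq:
  assumes m: "size m = n" "sq_sum m = q"
    and "mset w = m" "mset w' = m" "filter (\<lambda>y. k \<le> count m y) w = filter (\<lambda>y. k \<le> count m y) w'"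
  shows "P w = P w'"
  using assms(3-)
proof (induction k arbitrary: w w')
  case (Suc k)
  have swap: "P (u @ c # x # v) = P (u @ x # c # v)"
    if "mset (u @ c # x # v) = m" "c \<in> {y. count m y \<le> k}" for u v c x
  proof (cases "count m c = k")
    case True
    show ?thesis
      by (rule swap_step[OF m Suc.IH that(1) True])
  next
    case False
    then show ?thesis
      using that by (intro Suc.IH) auto
  qed
  have "P ([] @ w) = P ([] @ w')"
    by (rule rearrange_eqI[where m = m and S = "{y. count m y \<le> k}"], fact swap) (use Suc.prems in \<open>auto simp: not_le Suc_le_eq\<close>)
  then show ?case
    by simp
qed simp

text \<open>No letter of a word of length \<open>n\<close> reaches the threshold
  \<open>Suc n\<close>, so there the filters are empty. If the square sum is not \<open>q\<close>,
  both values are zero.\<close>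

lemma eq_if_mset_eq:
  assumes "length w = n" "mset w = mset w'"
  shows "P w = P w'"
proof (cases "sq_sum (mset w) = q")
  case True
  have "count (mset w) y \<le> n" for y
    using count_le_size[of "mset w" y] assms(1) by simp
  then have "filter (\<lambda>y. Suc n \<le> count (mset w) y) xs = []" for xs
    by (auto simp: not_le filter_empty_conv less_Suc_eq_le simp del: count_mset)
  then show ?thesis
    using assms True mset_eq_length[OF assms(2)] by (intro eq_if_big_eq[of "mset w" _ _ "Suc n"]) auto
next
  case False
  then show ?thesis
    using assms support by (metis size_mset)
qed

end

subsection \<open>Words and set partitions\<close>

text \<open>Positions in the word are shifted by one, since partitions live on \<open>{1..n}\<close>.\<close>

definition kernel :: "'a list \<Rightarrow> nat set set"
  where "kernel w = (\<lambda>y. {i \<in> {1..length w}. w ! (i - 1) = y}) ` set w"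

lemma same_block_kernel:
  "(\<exists>B\<in>kernel w. i \<in> B \<and> j \<in> B) \<longleftrightarrow>
    i \<in> {1..length w} \<and> j \<in> {1..length w} \<and> w ! (i - 1) = w ! (j - 1)"
  by (force simp: kernel_def)

lemma partition_on_kernel: "partition_on {1..length w} (kernel w)"
proof (rule partition_onI)
  show "\<Union> (kernel w) = {1..length w}"
    by (force simp: kernel_def)
  have "p \<noteq> {}" if p: "p \<in> kernel w" for p
  proof -
    obtain y where "y \<in> set w" "p = {i \<in> {1..length w}. w ! (i - 1) = y}"
      using p unfolding kernel_def by blast
    moreover from this obtain k where "k < length w" "y = w ! k"
      by (metis in_set_conv_nth)
    ultimately have "k < length w" "p = {i \<in> {1..length w}. w ! (i - 1) = w ! k}"
      by simp_all
    then have "Suc k \<in> p"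
      by auto
    then show ?thesis
      by blast
  qed
  then show "{} \<notin> kernel w"
    by blast
qed (auto simp: kernel_def disjnt_def)

lemma kernel_in_set_partitions: "length w = n \<Longrightarrow> kernel w \<in> set_partitions n"
  using partition_on_kernel[of w] by (simp add: set_partitions_def)

text \<open>The block of a point consists of the points related to it, and every block has a point.
  This allows \<open>kernel\<close> and \<open>delete_element\<close> to be compared without
  handling blocks.\<close>

lemma partition_on_eqI:
  assumes "partition_on A P" "partition_on A Q"
    and "\<And>i j. (\<exists>B\<in>P. i \<in> B \<and> j \<in> B) \<longleftrightarrow> (\<exists>B\<in>Q. i \<in> B \<and> j \<in> B)"
  shows "P = Q"
proof -
  have block: "B = {j. \<exists>C\<in>R. i \<in> C \<and> j \<in> C}" if "partition_on A R" "B \<in> R" "i \<in> B" for R B i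
    using that by (auto dest: partition_onD2 disjointD)
  have "R \<subseteq> S" if R: "partition_on A R" and S: "partition_on A S"
    and eq: "\<And>i j. (\<exists>B\<in>R. i \<in> B \<and> j \<in> B) \<longleftrightarrow> (\<exists>B\<in>S. i \<in> B \<and> j \<in> B)" for R S
  proof
    fix B assume B: "B \<in> R"
    then obtain i where i: "i \<in> B"
      using partition_onD3[OF R] by (metis ex_in_conv)
    then obtain C where C: "C \<in> S" "i \<in> C"
      using B eq[of i i] by blast
    have "B = C"
      unfolding block[OF R B i] block[OF S C] eq ..
    then show "B \<in> S"
      using C by simp
  qed
  from this[OF assms] this[OF assms(2,1) assms(3)[symmetric]] show ?thesis
    by (rule subset_antisym)
qed

lemma kernel_eq_iff:
  assumes "length w = length w'"
  shows "kernel w = kernel w' \<longleftrightarrow>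
    (\<forall>i<length w. \<forall>j<length w. w ! i = w ! j \<longleftrightarrow> w' ! i = w' ! j)"
proof
  assume eq: "kernel w = kernel w'"
  show "\<forall>i<length w. \<forall>j<length w. w ! i = w ! j \<longleftrightarrow> w' ! i = w' ! j"
  proof (intro allI impI)
    fix i j assume "i < length w" "j < length w"
    then show "w ! i = w ! j \<longleftrightarrow> w' ! i = w' ! j"
      using same_block_kernel[of w "Suc i" "Suc j", unfolded eq same_block_kernel] assms by simp
  qed
next
  assume *: "\<forall>i<length w. \<forall>j<length w. w ! i = w ! j \<longleftrightarrow> w' ! i = w' ! j"
  show "kernel w = kernel w'"
    by (rule partition_on_eqI[of "{1..length w}"])
       (use partition_on_kernel[of w] partition_on_kernel[of w'] assms *
         in \<open>auto simp: same_block_kernel\<close>)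
qed

lemma kernel_map_inj: "inj f \<Longrightarrow> kernel (map f w) = kernel w"
  by (simp add: kernel_eq_iff inj_eq)

section \<open>Deleting elements and deleting letters\<close>

lemma relabel_eq_iff:
  assumes "1 \<le> j"
  shows "a \<noteq> j \<and> relabel j a = i \<longleftrightarrow> a = (if i < j then i else Suc i)"
  using assms by (auto simp: relabel_def)

text \<open>The inverse of \<open>relabel j\<close> reopens the gap at \<open>j\<close>. Discarding
  the empty set changes nothing, as only blocks with points are tested.\<close>

lemma same_block_delete_element:
  assumes "1 \<le> j"
  shows "(\<exists>B\<in>delete_element j \<pi>. i \<in> B \<and> i' \<in> B) \<longleftrightarrow>
    (\<exists>B\<in>\<pi>. (if i < j then i else Suc i) \<in> B \<and> (if i' < j then i' else Suc i') \<in> B)"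
proof -
  have *: "x \<in> relabel j ` (B - {j}) \<longleftrightarrow> (if x < j then x else Suc x) \<in> B" for x B
  proof -
    have "x \<in> relabel j ` (B - {j}) \<longleftrightarrow> (\<exists>a\<in>B. a \<noteq> j \<and> relabel j a = x)"
      by auto
    then show ?thesis
      unfolding relabel_eq_iff[OF assms] by auto
  qed
  have "(\<exists>B\<in>delete_element j \<pi>. i \<in> B \<and> i' \<in> B) \<longleftrightarrow>
      (\<exists>B\<in>\<pi>. i \<in> relabel j ` (B - {j}) \<and> i' \<in> relabel j ` (B - {j}))"
  proof -
    have *: "(\<exists>C\<in>f ` (g ` S - {{}}). R C) \<longleftrightarrow> (\<exists>B\<in>S. g B \<noteq> {} \<and> R (f (g B)))"
      for f :: "nat set \<Rightarrow> nat set" and g :: "nat set \<Rightarrow> nat set" and S R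
      by blast
    show ?thesis
      unfolding delete_element_def * by (intro bex_cong refl) auto
  qed
  then show ?thesis
    unfolding * .
qed

lemma delete_element_kernel: "delete_element (Suc (length u)) (kernel (u @ c # v)) = kernel (u @ v)"
proof (rule partition_on_eqI)
  have "delete_element (Suc (length u)) (kernel (u @ c # v)) \<in> set_partitions (length (u @ c # v) - 1)"
    by (rule delete_element_in_set_partitions) (auto intro!: kernel_in_set_partitions)
  then show "partition_on {1..length (u @ v)} (delete_element (Suc (length u)) (kernel (u @ c # v)))"
    by (simp add: set_partitions_def)
  have nth: "(u @ c # v) ! ((if i < Suc (length u) then i else Suc i) - 1) = (u @ v) ! (i - 1)" if i: "1 \<le> i" for i
  proof -
    obtain k where "i = Suc k"
      using i by (cases i) auto
    then show ?thesis
      by (auto simp: nth_append Suc_diff_le)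
  qed
  show "(\<exists>B\<in>delete_element (Suc (length u)) (kernel (u @ c # v)). i \<in> B \<and> j \<in> B) \<longleftrightarrow>
    (\<exists>B\<in>kernel (u @ v). i \<in> B \<and> j \<in> B)" for i j
    using nth[of i] nth[of j]
    by (subst same_block_delete_element) (auto simp: same_block_kernel split: if_splits)
qed (rule partition_on_kernel)

text \<open>Two old positions, embedded by \<open>s\<close>, compare the shorter kernels; an old
  position and the new one compare where the inserted letter occurs; the new one with itself gives
  no condition.\<close>

lemma kernel_insert_eq_iff:
  assumes "length u = length u'" "length v = length v'"
  shows "kernel (u @ c # v) = kernel (u' @ c' # v') \<longleftrightarrow> kernel (u @ v) = kernel (u' @ v') \<and>
    (\<forall>i<length (u @ v). (u @ v) ! i = c \<longleftrightarrow> (u' @ v') ! i = c')"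
proof -
  define s where "s k = (if k < length u then k else Suc k)" for k
  have split: "(\<forall>i<Suc (length (u @ v)). Q i) \<longleftrightarrow> Q (length u) \<and> (\<forall>k<length (u @ v). Q (s k))" for Q
  proof (intro iffI conjI allI impI)
    fix i assume *: "Q (length u) \<and> (\<forall>k<length (u @ v). Q (s k))" and i: "i < Suc (length (u @ v))"
    consider "i = length u" | "i < length u" | k where "i = Suc k" "length u \<le> k"
      by (cases i) force+
    then show "Q i"
    proof cases
      case 2
      then show ?thesis
        using *[THEN conjunct2, rule_format, of i] by (auto simp: s_def)
    next
      case 3
      then show ?thesis
        using *[THEN conjunct2, rule_format, of k] i by (auto simp: s_def)
    qed (use * in simp)
  qed (auto simp: s_def)
  have s: "(u @ c # v) ! s k = (u @ v) ! k" "(u' @ c' # v') ! s k = (u' @ v') ! k" for k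
    using assms by (auto simp: s_def nth_append Suc_diff_le)
  have l: "(u @ c # v) ! length u = c" "(u' @ c' # v') ! length u = c'"
    using assms by (simp_all add: nth_append)
  have "kernel (u @ c # v) = kernel (u' @ c' # v') \<longleftrightarrow>
    (\<forall>i<Suc (length (u @ v)). \<forall>j<Suc (length (u @ v)).
      (u @ c # v) ! i = (u @ c # v) ! j \<longleftrightarrow> (u' @ c' # v') ! i = (u' @ c' # v') ! j)"
    using assms by (subst kernel_eq_iff) auto
  also have "\<dots> \<longleftrightarrow> kernel (u @ v) = kernel (u' @ v') \<and>
    (\<forall>i<length (u @ v). (u @ v) ! i = c \<longleftrightarrow> (u' @ v') ! i = c')"
    unfolding split s l using assms by (subst kernel_eq_iff) auto
  finally show ?thesis .
qed

text \<open>The letter of \<open>i\<close> is the index in \<open>xs\<close> of its block, so the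
  order of \<open>xs\<close> decides which letter gets which block size as multiplicity.\<close>

lemma partition_word:
  assumes part: "partition_on {1..n} \<pi>" and xs: "distinct xs" "set xs = \<pi>"
  obtains w where "length w = n" "kernel w = \<pi>"
    "\<And>j. count (mset w) j = (if j < length xs then card (xs ! j) else 0)"
proof -
  have "\<exists>k. k < length xs \<and> i \<in> xs ! k" if "i \<in> {1..n}" for i
    using that xs(2) partition_onD1[OF part] by (metis UnionE in_set_conv_nth)
  then obtain f where f: "\<And>i. i \<in> {1..n} \<Longrightarrow> f i < length xs \<and> i \<in> xs ! f i"
    by metis
  have uniq: "i \<in> {1..n} \<and> f i = k" if "k < length xs" "i \<in> xs ! k" for i k
  proof -
    have "xs ! k \<in> \<pi>"
      using that xs by auto
    moreover from this have i: "i \<in> {1..n}"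
      using that(2) partition_onD1[OF part] by auto
    moreover have "xs ! f i \<in> \<pi>"
      using f[OF i] xs by auto
    ultimately have "xs ! k = xs ! f i"
      using partition_onD2[OF part] f[OF i] that(2) by (auto dest: disjointD)
    then show ?thesis
      using f[OF i] i that(1) xs(1) nth_eq_iff_index_eq by blast
  qed
  define w where "w = map f [1..<Suc n]"
  have w: "w ! (i - 1) = f i" if "i \<in> {1..n}" for i
    using that unfolding w_def by (subst nth_map) (auto simp del: upt_Suc)
  have len: "length w = n"
    by (simp add: w_def)
  show ?thesis
  proof
    show "kernel w = \<pi>"
    proof (rule partition_on_eqI[OF _ part])
      show "partition_on {1..n} (kernel w)"
        using partition_on_kernel[of w] len by simp
      show "(\<exists>B\<in>kernel w. i \<in> B \<and> j \<in> B) \<longleftrightarrow> (\<exists>B\<in>\<pi>. i \<in> B \<and> j \<in> B)" for i j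
      proof -
        have "(\<exists>B\<in>\<pi>. i \<in> B \<and> j \<in> B) \<longleftrightarrow> (\<exists>k<length xs. i \<in> xs ! k \<and> j \<in> xs ! k)"
          using xs(2) by (metis in_set_conv_nth)
        also have "\<dots> \<longleftrightarrow> i \<in> {1..n} \<and> j \<in> {1..n} \<and> f i = f j"
          using f uniq by metis
        finally show ?thesis
          unfolding same_block_kernel len using w by auto
      qed
    qed
    have "mset w = image_mset f (mset_set {1..n})"
      unfolding w_def by (simp add: mset_map mset_upt atLeastLessThanSuc_atLeastAtMost del: upt_Suc)
    then have "count (mset w) j = card {i \<in> {1..n}. f i = j}" for j
      by (simp add: count_image_mset_eq_card_vimage)
    moreover have "{i \<in> {1..n}. f i = j} = (if j < length xs then xs ! j else {})" for j
      using f uniq by auto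
    ultimately show "count (mset w) j = (if j < length xs then card (xs ! j) else 0)" for j
      by simp
  qed (fact len)
qed

section \<open>Shapes and letter multiplicities\<close>

lemma finite_set_partitions: "finite (set_partitions n)"
  unfolding set_partitions_def by (rule finitely_many_partition_on) simp

lemma finite_if_set_partition: "\<pi> \<in> set_partitions n \<Longrightarrow> finite \<pi>"
  by (auto simp: set_partitions_def intro: finite_elements)

lemma kernel_surj:
  assumes "\<pi> \<in> set_partitions n"
  obtains w :: "nat list" where "length w = n" "kernel w = \<pi>"
  using assms partition_word finite_distinct_list[OF finite_if_set_partition[OF assms]]
  unfolding set_partitions_def by (metis mem_Collect_eq)

text \<open>With the blocks of both partitions listed by nondecreasing size, equal shapes give equal
  sizes at each index, hence equal letter multiplicities.\<close>

lemma ranked_shape_eq_words: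
  assumes "\<pi> \<in> set_partitions n" "\<rho> \<in> set_partitions n" "ranked_shape \<pi> = ranked_shape \<rho>"
  obtains w w' :: "nat list" where "length w = n" "mset w = mset w'" "kernel w = \<pi>" "kernel w' = \<rho>"
proof -
  have ex: "\<exists>xs. distinct xs \<and> set xs = \<sigma> \<and> map card xs = rev (ranked_shape \<sigma>)"
    if \<sigma>: "\<sigma> \<in> set_partitions n" for \<sigma>
  proof -
    obtain ys where ys: "set ys = \<sigma>" "distinct ys"
      using finite_distinct_list[OF finite_if_set_partition[OF \<sigma>]] by auto
    have "mset (map card (sort_key card ys)) = image_mset card (mset_set \<sigma>)"
      using ys by (auto simp: mset_set_set)
    then have "rev (ranked_shape \<sigma>) = sort (map card (sort_key card ys))"
      unfolding ranked_shape_def by (metis rev_rev_ident sorted_list_of_multiset_mset)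
    also have "\<dots> = map card (sort_key card ys)"
      by (rule sorted_sort_id) simp
    finally show ?thesis
      using ys by (intro exI[of _ "sort_key card ys"]) auto
  qed
  obtain xs where xs: "distinct xs" "set xs = \<pi>" "map card xs = rev (ranked_shape \<pi>)"
    using ex[OF assms(1)] by auto
  obtain ys where ys: "distinct ys" "set ys = \<rho>" "map card ys = rev (ranked_shape \<rho>)"
    using ex[OF assms(2)] by auto
  have eq: "map card xs = map card ys"
    using xs(3) ys(3) assms(3) by simp
  obtain w where w: "length w = n" "kernel w = \<pi>"
    "\<And>j. count (mset w) j = (if j < length xs then card (xs ! j) else 0)"
    using partition_word[OF _ xs(1,2)] assms(1) unfolding set_partitions_def by auto
  obtain w' where w': "length w' = n" "kernel w' = \<rho>"
    "\<And>j. count (mset w') j = (if j < length ys then card (ys ! j) else 0)"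
    using partition_word[OF _ ys(1,2)] assms(2) unfolding set_partitions_def by auto
  have "count (mset w) j = count (mset w') j" for j
    using arg_cong[OF eq, of "\<lambda>l. l ! j"] arg_cong[OF eq, of length] unfolding w(3) w'(3)
    by (auto simp del: nth_map) (metis nth_map)
  then show ?thesis
    using that w w' by (metis multiset_eqI)
qed

lemma sum_list_ranked_shape:
  assumes "finite \<pi>"
  shows "sum_list (map f (ranked_shape \<pi>)) = (\<Sum>B\<in>\<pi>. f (card B))"
proof -
  have "mset (ranked_shape \<pi>) = image_mset card (mset_set \<pi>)"
    by (simp add: ranked_shape_def)
  then have "sum_list (map f (ranked_shape \<pi>)) = sum_mset (image_mset f (image_mset card (mset_set \<pi>)))"
    by (metis mset_map sum_mset_sum_list)
  then show ?thesis
    by (simp add: multiset.map_comp sum_unfold_sum_mset comp_def)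
qed

text \<open>Distinct letters of \<open>w\<close> have distinct blocks, of size equal to their
  multiplicity. With \<open>sum_list_ranked_shape\<close>, the square sum of a word thus depends
  only on the shape of its kernel.\<close>

lemma sq_sum_kernel: "(\<Sum>B\<in>kernel w. (card B)\<^sup>2) = sq_sum (mset w)"
proof -
  define b where "b y = {i \<in> {1..length w}. w ! (i - 1) = y}" for y
  have "w = map (\<lambda>i. w ! (i - 1)) [1..<Suc (length w)]"
    by (rule nth_equalityI) (auto simp del: upt_Suc)
  then have "mset w = image_mset (\<lambda>i. w ! (i - 1)) (mset_set {1..length w})"
    by (metis mset_map mset_upt atLeastLessThanSuc_atLeastAtMost)
  then have card: "count (mset w) y = card (b y)" for y
    unfolding b_def by (metis (no_types) count_image_mset_eq_card_vimage finite_atLeastAtMost)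
  have "inj_on b (set w)"
  proof (rule inj_onI)
    fix x y assume "x \<in> set w" "b x = b y"
    then obtain k where k: "k < length w" "w ! k = x"
      by (auto simp: in_set_conv_nth)
    then have "Suc k \<in> b x"
      by (simp add: b_def)
    then have "Suc k \<in> b y"
      using \<open>b x = b y\<close> by simp
    then show "x = y"
      using k by (simp add: b_def)
  qed
  moreover have "kernel w = b ` set w"
    by (simp add: kernel_def b_def)
  ultimately show ?thesis
    by (simp add: sum.reindex sq_sum_def card del: count_mset)
qed

text \<open>The extra element joins an old block, named by a letter of \<open>u @ v\<close>, or
  forms a block of its own, named by \<open>z\<close>. Sums over fibres of deletion thereby become
  sums over letters.\<close>

lemma bij_betw_kernel_insert:
  assumes z: "z \<notin> set (u @ v)"
  shows "bij_betw (\<lambda>c. kernel (u @ c # v)) (insert z (set (u @ v)))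
    {\<pi> \<in> set_partitions (Suc (length (u @ v))). delete_element (Suc (length u)) \<pi> = kernel (u @ v)}"
    (is "bij_betw ?K ?A ?F")
proof (rule bij_betwI')
  show "?K c = ?K d \<longleftrightarrow> c = d" if "c \<in> ?A" "d \<in> ?A" for c d
  proof
    assume "?K c = ?K d"
    then have "(u @ v) ! i = c \<longleftrightarrow> (u @ v) ! i = d" if "i < length (u @ v)" for i
      using that by (simp add: kernel_insert_eq_iff)
    then show "c = d"
      using that by (metis in_set_conv_nth insertE)
  qed simp
  show "?K c \<in> ?F" if "c \<in> ?A" for c
    by (simp add: delete_element_kernel kernel_in_set_partitions)
  show "\<exists>c\<in>?A. \<pi> = ?K c" if \<pi>: "\<pi> \<in> ?F" for \<pi>
  proof -
    obtain w :: "nat list" where w: "length w = Suc (length (u @ v))" "kernel w = \<pi>"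
      using \<pi> kernel_surj by blast
    define u' c' v' where "u' = take (length u) w" and "c' = w ! length u" and "v' = drop (Suc (length u)) w"
    have w_eq: "w = u' @ c' # v'" and len: "length u' = length u" "length v' = length v"
      using w(1) by (auto simp: u'_def c'_def v'_def id_take_nth_drop)
    have "delete_element (Suc (length u)) \<pi> = kernel (u' @ v')"
      using delete_element_kernel[of u' c' v'] w(2) len by (simp add: w_eq)
    then have k: "kernel (u' @ v') = kernel (u @ v)"
      using \<pi> by simp
    then have k': "(u' @ v') ! i = (u' @ v') ! j \<longleftrightarrow> (u @ v) ! i = (u @ v) ! j"
      if "i < length (u @ v)" "j < length (u @ v)" for i j
      using that len by (subst (asm) kernel_eq_iff) auto
    \<comment> \<open>The word \<open>w\<close> may use other letters than \<open>u @ v\<close>. Its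
      letter \<open>c'\<close> is translated through a common position, or to \<open>z\<close> if it
      occurs nowhere else.\<close>
    obtain c where "c \<in> ?A" "\<And>i. i < length (u @ v) \<Longrightarrow> (u' @ v') ! i = c' \<longleftrightarrow> (u @ v) ! i = c"
    proof (cases "\<exists>i<length (u @ v). (u' @ v') ! i = c'")
      case True
      then obtain i where "i < length (u @ v)" "(u' @ v') ! i = c'"
        by blast
      then show ?thesis
        using that[of "(u @ v) ! i"] k' by (metis insertCI nth_mem)
    next
      case False
      then show ?thesis
        using that[of z] z by (metis insertI1 nth_mem)
    qed
    moreover from this have "kernel (u' @ c' # v') = kernel (u @ c # v)"
      using len k by (subst kernel_insert_eq_iff) auto
    ultimately show ?thesis
      using w w_eq by blast
  qed
qed

lemma spread_words_kernel:
  assumes spread: "\<And>\<pi>' i j. \<pi>' \<in> set_partitions (n - 1) \<Longrightarrow> i \<in> {1..n} \<Longrightarrow> j \<in> {1..n} \<Longrightarrow>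
      (\<Sum>\<pi> | \<pi> \<in> set_partitions n \<and> delete_element i \<pi> = \<pi>'. p \<pi>) =
      (\<Sum>\<pi> | \<pi> \<in> set_partitions n \<and> delete_element j \<pi> = \<pi>'. p \<pi>)"
    and support: "\<And>\<pi>. \<pi> \<in> set_partitions n \<Longrightarrow> p \<pi> \<noteq> 0 \<Longrightarrow> (\<Sum>B\<in>\<pi>. (card B)\<^sup>2) = q"
  shows "spread_words (\<lambda>w. p (kernel w)) n q"
proof
  fix u v :: "nat list" and x z :: nat
  assume n: "Suc (length (u @ x # v)) = n" and z: "z \<notin> set (u @ x # v)"
  have "(\<Sum>c\<in>insert z (set (u @ x # v)). p (kernel (u @ c # x # v))) =
      (\<Sum>\<pi> | \<pi> \<in> set_partitions n \<and> delete_element (Suc (length u)) \<pi> = kernel (u @ x # v). p \<pi>)"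
    using sum.reindex_bij_betw[OF bij_betw_kernel_insert[OF z], of p] n by simp
  \<comment> \<open>Spreadability enters for the positions directly before and directly behind
    \<open>x\<close>.\<close>
  also have "\<dots> = (\<Sum>\<pi> | \<pi> \<in> set_partitions n \<and> delete_element (Suc (length (u @ [x]))) \<pi> = kernel (u @ x # v). p \<pi>)"
    using n by (intro spread kernel_in_set_partitions) auto
  also have "\<dots> = (\<Sum>c\<in>insert z (set (u @ x # v)). p (kernel (u @ x # c # v)))"
    using sum.reindex_bij_betw[OF bij_betw_kernel_insert[of z "u @ [x]" v], of p] n z by simp
  finally show "(\<Sum>c\<in>insert z (set (u @ x # v)). p (kernel (u @ c # x # v))) =
      (\<Sum>c\<in>insert z (set (u @ x # v)). p (kernel (u @ x # c # v)))" .
next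
  fix w :: "nat list" assume "length w = n" "p (kernel w) \<noteq> 0"
  then show "sq_sum (mset w) = q"
    using support kernel_in_set_partitions sq_sum_kernel by metis
qed (simp add: kernel_map_inj)

subsection \<open>Random partitions\<close>

lemma random_partition_sets:
  assumes "random_partition n M X"
  shows "{w \<in> space M. X w = \<pi>} \<in> sets M"
proof -
  have X: "X \<in> measurable M (count_space (set_partitions n))"
    using assms by (simp add: random_partition_def)
  have "X -` ({\<pi>} \<inter> set_partitions n) \<inter> space M \<in> sets M"
    by (rule measurable_sets[OF X]) simp
  also have "X -` ({\<pi>} \<inter> set_partitions n) \<inter> space M = {w \<in> space M. X w = \<pi>}"
    using measurable_space[OF X] by auto
  finally show ?thesis .
qed

lemma measure_random_partition:
  assumes X: "random_partition n M X"
  shows "measure M {w \<in> space M. Q (X w)} = (\<Sum>\<pi> | \<pi> \<in> set_partitions n \<and> Q \<pi>. probability_function M X \<pi>)"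
proof -
  interpret prob_space M
    using X by (simp add: random_partition_def)
  have "{w \<in> space M. Q (X w)} = (\<Union>\<pi>\<in>{\<pi>. \<pi> \<in> set_partitions n \<and> Q \<pi>}. {w \<in> space M. X w = \<pi>})"
    using X by (auto simp: random_partition_def dest: measurable_space)
  then show ?thesis
    unfolding probability_function_def
    by (simp only:) (rule finite_measure_finite_Union,
        use random_partition_sets[OF X] finite_set_partitions in \<open>auto simp: disjoint_family_on_def\<close>)
qed

lemma measurable_delete_element:
  assumes "random_partition n M X" "i \<in> {1..n}"
  shows "(\<lambda>w. delete_element i (X w)) \<in> measurable M (count_space (set_partitions (n - 1)))"
proof -
  have X: "X \<in> measurable M (count_space (set_partitions n))"
    using assms(1) by (simp add: random_partition_def)
  have "delete_element i \<in> measurable (count_space (set_partitions n)) (count_space (set_partitions (n - 1)))"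
    using delete_element_in_set_partitions[OF _ assms(2)] by simp
  then show ?thesis
    by (rule measurable_compose[OF X])
qed

lemma measure_distr_delete_element:
  assumes X: "random_partition n M X" and i: "i \<in> {1..n}" and \<pi>': "\<pi>' \<in> set_partitions (n - 1)"
  shows "measure (distr M (count_space (set_partitions (n - 1))) (\<lambda>w. delete_element i (X w))) {\<pi>'} =
    (\<Sum>\<pi> | \<pi> \<in> set_partitions n \<and> delete_element i \<pi> = \<pi>'. probability_function M X \<pi>)"
proof -
  have "measure (distr M (count_space (set_partitions (n - 1))) (\<lambda>w. delete_element i (X w))) {\<pi>'} =
      measure M ((\<lambda>w. delete_element i (X w)) -` {\<pi>'} \<inter> space M)"
    using \<pi>' by (intro measure_distr measurable_delete_element[OF X i]) simp
  also have "(\<lambda>w. delete_element i (X w)) -` {\<pi>'} \<inter> space M = {w \<in> space M. delete_element i (X w) = \<pi>'}"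
    by auto
  finally show ?thesis
    by (simp only: measure_random_partition[OF X, of "\<lambda>\<pi>. delete_element i \<pi> = \<pi>'"])
qed

text \<open>The probability function is constant on the shape by the result on words and zero
  elsewhere; total mass 1 fixes the constant. Phrasing the shape condition through nonzero
  probabilities lets the lemma apply also to the parts of a convex decomposition.\<close>

lemma probability_function_eq_p_star:
  assumes X: "random_partition n M X" and spread: "spreadable n M X"
    and shape: "\<And>\<pi>. \<pi> \<in> set_partitions n \<Longrightarrow> probability_function M X \<pi> \<noteq> 0 \<Longrightarrow> ranked_shape \<pi> = lam"
  shows "probability_function M X = p_star n lam" "partitions_of_shape n lam \<noteq> {}"
proof -
  let ?p = "probability_function M X"
  interpret prob_space M
    using X by (simp add: random_partition_def)
  interpret spread_words "\<lambda>w. ?p (kernel w)" n "sum_list (map (\<lambda>k. k\<^sup>2) lam)"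
  proof (rule spread_words_kernel)
    fix \<pi>' i j assume *: "\<pi>' \<in> set_partitions (n - 1)" "i \<in> {1..n}" "j \<in> {1..n}"
    have "distr M (count_space (set_partitions (n - 1))) (\<lambda>w. delete_element i (X w)) =
        distr M (count_space (set_partitions (n - 1))) (\<lambda>w. delete_element j (X w))"
      by (rule spread[unfolded spreadable_def, rule_format, OF *(2,3)])
    then show "(\<Sum>\<pi> | \<pi> \<in> set_partitions n \<and> delete_element i \<pi> = \<pi>'. ?p \<pi>) =
        (\<Sum>\<pi> | \<pi> \<in> set_partitions n \<and> delete_element j \<pi> = \<pi>'. ?p \<pi>)"
      using measure_distr_delete_element[OF X *(2,1)] measure_distr_delete_element[OF X *(3,1)] by simp
  next
    fix \<pi> assume "\<pi> \<in> set_partitions n" "?p \<pi> \<noteq> 0"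
    then show "(\<Sum>B\<in>\<pi>. (card B)\<^sup>2) = sum_list (map (\<lambda>k. k\<^sup>2) lam)"
      using shape[of \<pi>] sum_list_ranked_shape[OF finite_if_set_partition, of \<pi> n "\<lambda>k. k\<^sup>2"] by simp
  qed
  have const: "?p \<pi> = ?p \<rho>" if "\<pi> \<in> partitions_of_shape n lam" "\<rho> \<in> partitions_of_shape n lam" for \<pi> \<rho>
  proof -
    have "\<pi> \<in> set_partitions n" "\<rho> \<in> set_partitions n" "ranked_shape \<pi> = ranked_shape \<rho>"
      using that by (auto simp: partitions_of_shape_def)
    then obtain w w' :: "nat list" where "length w = n" "mset w = mset w'" "kernel w = \<pi>" "kernel w' = \<rho>"
      by (rule ranked_shape_eq_words)
    then show ?thesis
      using eq_if_mset_eq by blast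
  qed
  have zero: "?p \<pi> = 0" if "\<pi> \<notin> partitions_of_shape n lam" for \<pi>
  proof (cases "\<pi> \<in> set_partitions n")
    case True
    then show ?thesis
      using that shape by (auto simp: partitions_of_shape_def)
  next
    case False
    then have "{w \<in> space M. X w = \<pi>} = {}"
      using X by (auto simp: random_partition_def dest: measurable_space)
    then show ?thesis
      by (simp only: probability_function_def measure_empty)
  qed
  have "1 = (\<Sum>\<pi>\<in>set_partitions n. ?p \<pi>)"
    using measure_random_partition[OF X, of "\<lambda>_. True"] by (simp add: prob_space)
  also have "\<dots> = (\<Sum>\<pi>\<in>partitions_of_shape n lam. ?p \<pi>)"
    using zero by (intro sum.mono_neutral_right finite_set_partitions) (auto simp: partitions_of_shape_def)
  finally have total: "(\<Sum>\<pi>\<in>partitions_of_shape n lam. ?p \<pi>) = 1"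
    by simp
  then show "partitions_of_shape n lam \<noteq> {}"
    by auto
  show "?p = p_star n lam"
  proof
    fix \<pi>
    show "?p \<pi> = p_star n lam \<pi>"
    proof (cases "\<pi> \<in> partitions_of_shape n lam")
      case True
      then have "(\<Sum>\<rho>\<in>partitions_of_shape n lam. ?p \<rho>) = (\<Sum>\<rho>\<in>partitions_of_shape n lam. ?p \<pi>)"
        by (intro sum.cong refl const)
      with total have "real (card (partitions_of_shape n lam)) * ?p \<pi> = 1"
        by simp
      moreover from this have "card (partitions_of_shape n lam) \<noteq> 0"
        by (metis mult_zero_left of_nat_0 zero_neq_one)
      ultimately show ?thesis
        using True by (simp add: p_star_def nonzero_eq_divide_eq mult.commute)
    qed (simp add: zero p_star_def)
  qed
qed

section \<open>Spreadable distributions and extremality\<close>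

lemma prob_distr_random_partition:
  assumes X: "random_partition n M X"
  shows "probability_function (distr M (count_space (set_partitions n)) X) (\<lambda>\<pi>. \<pi>) = probability_function M X"
proof
  fix \<pi>
  have m: "X \<in> measurable M (count_space (set_partitions n))"
    using X by (simp add: random_partition_def)
  have "measure (distr M (count_space (set_partitions n)) X) ({\<pi>} \<inter> set_partitions n) =
      measure M (X -` ({\<pi>} \<inter> set_partitions n) \<inter> space M)"
    by (rule measure_distr[OF m]) simp
  moreover have "{\<pi>'. \<pi>' \<in> set_partitions n \<and> \<pi>' = \<pi>} = {\<pi>} \<inter> set_partitions n"
    by auto
  moreover have "X -` ({\<pi>} \<inter> set_partitions n) \<inter> space M = {w \<in> space M. X w = \<pi>}"
    using measurable_space[OF m] by auto
  ultimately show "probability_function (distr M (count_space (set_partitions n)) X) (\<lambda>\<pi>. \<pi>) \<pi> =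
      probability_function M X \<pi>"
    by (simp add: probability_function_def)
qed

text \<open>The law of \<open>X\<close> is the witness: under it the identity has the same
  probability function and the same laws after deletion as \<open>X\<close>.\<close>

lemma probability_function_in_spreadable_distributions:
  assumes X: "random_partition n M X" and spread: "spreadable n M X"
  shows "probability_function M X \<in> spreadable_distributions n"
proof -
  let ?\<mu> = "distr M (count_space (set_partitions n)) X"
  have m: "X \<in> measurable M (count_space (set_partitions n))"
    using X by (simp add: random_partition_def)
  have "distr ?\<mu> (count_space (set_partitions (n - 1))) (delete_element i) =
      distr M (count_space (set_partitions (n - 1))) (\<lambda>w. delete_element i (X w))" if "i \<in> {1..n}" for i
    using distr_distr[OF _ m, of "delete_element i" "count_space (set_partitions (n - 1))"]
      delete_element_in_set_partitions[OF _ that] by (simp add: comp_def)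
  then have "spreadable n ?\<mu> (\<lambda>\<pi>. \<pi>)"
    using spread unfolding spreadable_def by metis
  moreover have "prob_space ?\<mu>"
    using X m by (intro prob_space.prob_space_distr) (auto simp: random_partition_def)
  ultimately show ?thesis
    unfolding spreadable_distributions_def
    by (intro CollectI exI[of _ ?\<mu>]) (simp add: prob_distr_random_partition[OF X])
qed

lemma spreadable_distributionsE:
  assumes "a \<in> spreadable_distributions n"
  obtains \<mu> where "random_partition n \<mu> (\<lambda>\<pi>. \<pi>)" "spreadable n \<mu> (\<lambda>\<pi>. \<pi>)" "a = probability_function \<mu> (\<lambda>\<pi>. \<pi>)"
proof -
  obtain \<mu> where \<mu>: "a = probability_function \<mu> (\<lambda>\<pi>. \<pi>)" "prob_space \<mu>" "spreadable n \<mu> (\<lambda>\<pi>. \<pi>)"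
    and "sets \<mu> = sets (count_space (set_partitions n))"
    using assms unfolding spreadable_distributions_def by blast
  then have "(\<lambda>\<pi>. \<pi>) \<in> measurable \<mu> (count_space (set_partitions n))"
    by (intro measurable_ident_sets)
  with \<mu> that show ?thesis
    by (simp add: random_partition_def)
qed

lemma p_star_extreme_point:
  assumes "p_star n lam \<in> spreadable_distributions n"
  shows "p_star n lam extreme_point_of spreadable_distributions n"
  unfolding extreme_point_of_def
proof (intro conjI ballI notI)
  fix a b assume ab: "a \<in> spreadable_distributions n" "b \<in> spreadable_distributions n"
    and "p_star n lam \<in> open_segment a b"
  then obtain t where "a \<noteq> b" and t: "0 < t" "t < 1"
    and eq: "p_star n lam = (1 - t) *\<^sub>R a + t *\<^sub>R b"
    by (auto simp: in_segment)
  have nonneg: "0 \<le> c \<pi>" if "c \<in> spreadable_distributions n" for c \<pi>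
    using that by (auto simp: spreadable_distributions_def probability_function_def)
  \<comment> \<open>Two nonnegative values with positive weights can only average to zero if both
    are zero, so \<open>a\<close> and \<open>b\<close> are concentrated on the shape.\<close>
  have "a \<pi> = 0 \<and> b \<pi> = 0" if "\<pi> \<in> set_partitions n" "ranked_shape \<pi> \<noteq> lam" for \<pi>
  proof -
    have "p_star n lam \<pi> = 0"
      using that by (simp add: p_star_def partitions_of_shape_def)
    then have "(1 - t) * a \<pi> + t * b \<pi> = 0"
      unfolding eq by (simp add: scaleR_fun_def)
    moreover have "0 \<le> (1 - t) * a \<pi>" "0 \<le> t * b \<pi>"
      using t nonneg ab by auto
    ultimately show ?thesis
      using t by (simp add: add_nonneg_eq_0_iff)
  qed
  then have "c = p_star n lam" if "c \<in> {a, b}" for c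
    using that ab by (metis spreadable_distributionsE probability_function_eq_p_star(1) insertE singletonD)
  from this[of a] this[of b] show False
    using \<open>a \<noteq> b\<close> by simp
qed (rule assms)

theorem proposition4:
  fixes n :: nat
    and lam :: "nat list"
    and M :: "'w measure"
    and X :: "'w \<Rightarrow> nat set set"
  assumes "n \<ge> 1"
    and "integer_partition n lam"
    and "random_partition n M X"
    and "spreadable n M X"
    and "AE w in M. ranked_shape (X w) = lam"
  shows "exchangeable n M X \<and>
    distr M (count_space (set_partitions n)) X =
      uniform_measure (count_space (set_partitions n)) (partitions_of_shape n lam) \<and>
    probability_function M X = p_star n lam \<and>
    probability_function M X extreme_point_of spreadable_distributions n"
proof -
  let ?S = "partitions_of_shape n lam" and ?P = "count_space (set_partitions n)"
  note X = assms(3) and spread = assms(4)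
  interpret prob_space M
    using X by (simp add: random_partition_def)
  have m: "X \<in> measurable M ?P"
    using X by (simp add: random_partition_def)
  have shape: "ranked_shape \<pi> = lam" if "probability_function M X \<pi> \<noteq> 0" for \<pi>
  proof (rule ccontr)
    assume "ranked_shape \<pi> \<noteq> lam"
    then have "AE w in M. X w \<noteq> \<pi>"
      using assms(5) by (auto elim: eventually_mono)
    then have "\<P>(w in M. X w = \<pi>) = 0"
      using random_partition_sets[OF X] by (subst prob_eq_0) auto
    with that show False
      by (simp add: probability_function_def)
  qed
  then have p: "probability_function M X = p_star n lam" "?S \<noteq> {}"
    using probability_function_eq_p_star[OF X spread] by blast+
  have fin: "finite ?S"
    by (rule finite_subset[OF _ finite_set_partitions[of n]]) (auto simp: partitions_of_shape_def)
  have "exchangeable n M X"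
    unfolding exchangeable_def
    using p(1) by (simp add: probability_function_def p_star_def partitions_of_shape_def fun_eq_iff)
  moreover have "distr M ?P X = uniform_measure ?P ?S"
  proof (rule measure_eqI_finite)
    fix \<pi> assume \<pi>: "\<pi> \<in> set_partitions n"
    have "emeasure (distr M ?P X) {\<pi>} = emeasure M (X -` {\<pi>} \<inter> space M)"
      using \<pi> by (intro emeasure_distr[OF m]) simp
    also have "X -` {\<pi>} \<inter> space M = {w \<in> space M. X w = \<pi>}"
      by auto
    also have "emeasure M \<dots> = ennreal (p_star n lam \<pi>)"
      unfolding p(1)[symmetric] probability_function_def by (rule emeasure_eq_measure)
    \<comment> \<open>The intersection has mass 1 or 0 according to whether \<pi> has the shape, and
      \<open>?S\<close> has finite positive mass \<open>card ?S\<close>.\<close>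
    also have "\<dots> = emeasure ?P (?S \<inter> {\<pi>}) / emeasure ?P ?S"
    proof -
      have S: "?S \<subseteq> set_partitions n"
        by (auto simp: partitions_of_shape_def)
      have "card ?S > 0"
        using p(2) fin by (simp add: card_gt_0_iff)
      then show ?thesis
        using S fin \<pi>
        by (auto simp: p_star_def divide_ennreal[symmetric] ennreal_of_nat_eq_real_of_nat Int_insert_right)
    qed
    also have "\<dots> = emeasure (uniform_measure ?P ?S) {\<pi>}"
      using \<pi> by (intro emeasure_uniform_measure[symmetric]) (auto simp: partitions_of_shape_def)
    finally show "emeasure (distr M ?P X) {\<pi>} = emeasure (uniform_measure ?P ?S) {\<pi>}" .
  qed (use finite_set_partitions in auto)
  moreover have "probability_function M X extreme_point_of spreadable_distributions n"
    using p_star_extreme_point probability_function_in_spreadable_distributions[OF X spread]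
    by (simp add: p(1))
  ultimately show ?thesis
    using p(1) by blast
qed

end
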